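(* Let $(X,T),(Y,S)$ be topological dynamical systems and $f\in C(X\times Y)$. (a) If $(X,T)$ and $(Y,S)$ both have the periodic specification property, then $\alpha(f)\le\delta(f)$. (b) If $(Y,S)$ has the periodic specification property, then $\alpha(f)\ge\delta(f)$. In particular, if both have the periodic specification property, then $\alpha(f)=\delta(f)$.
   Context: A topological dynamical system $(X,T)$: $X$ compact metrizable, $T$ a homeomorphism; $\mathcal{M}_T(X)$ its invariant Borel probability measures. With $\pi_Y(x,y)=y$: $\psi_f(\nu)=\min\{\int f\,d\lambda:\lambda\in\mathcal{M}_{T\times S}(X\times Y),(\pi_Y)_*\lambda=\nu\}$, $\alpha(f)=\sup_{\nu\in\mathcal{M}_S(Y)}\psi_f(\nu)$, and $\delta(f)=\limsup_{k\to\infty}\max_{y\in Y}\min_{x\in X}\frac1k\sum_{j=0}^{k-1}f(T^jx,S^jy)$. A specification in $X$ is $\xi=(x_i,[a_i,b_i])_{i=1}^n$ with integers $a_1\le b_1<a_2\le\dots<a_n\le b_n$; $D$-spaced if $a_{i+1}-b_i\ge D$; $x$ is an $\eta$-tracing if $d(T^jx,T^jx_i)<\eta$ for all $i$, $j\in[a_i,b_i]$ ($d$ a compatible metric). $(X,T)$ has the periodic specification property if for each $\eta>0$ there is $D(\eta)\in\mathbb{N}$ such that every $D(\eta)$-spaced specification has an $\eta$-tracing $x'$ with $T^{b_n-a_1+D(\eta)}x'=x'$. *)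

theory Defs
  imports "HOL-Probability.Probability"
begin

definition tds :: "('a::metric_space \<Rightarrow> 'a) \<Rightarrow> bool" where
  "tds T \<longleftrightarrow> compact (UNIV :: 'a set) \<and> bij T \<and> continuous_on UNIV T \<and> continuous_on UNIV (inv T)"

definition iter :: "('a \<Rightarrow> 'a) \<Rightarrow> int \<Rightarrow> 'a \<Rightarrow> 'a" where
  "iter T j = (if 0 \<le> j then T ^^ nat j else inv T ^^ nat (- j))"

definition inv_measures :: "('a::topological_space \<Rightarrow> 'a) \<Rightarrow> 'a measure set" where
  "inv_measures T = {M. prob_space M \<and> sets M = sets borel \<and> distr M borel T = M}"

definition psi :: "('a::topological_space \<times> 'b::topological_space \<Rightarrow> real) \<Rightarrow> ('a \<Rightarrow> 'a) \<Rightarrow> ('b \<Rightarrow> 'b)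
    \<Rightarrow> 'b measure \<Rightarrow> real" where
  "psi f T S \<nu> = Inf {integral\<^sup>L L f | L.
      L \<in> inv_measures (\<lambda>(x, y). (T x, S y)) \<and> distr L borel snd = \<nu>}"

definition alpha :: "('a::topological_space \<times> 'b::topological_space \<Rightarrow> real) \<Rightarrow> ('a \<Rightarrow> 'a) \<Rightarrow> ('b \<Rightarrow> 'b) \<Rightarrow> real" where
  "alpha f T S = Sup {psi f T S \<nu> | \<nu>. \<nu> \<in> inv_measures S}"

definition delta :: "('a \<times> 'b \<Rightarrow> real) \<Rightarrow> ('a \<Rightarrow> 'a) \<Rightarrow> ('b \<Rightarrow> 'b) \<Rightarrow> ereal" where
  "delta f T S = limsup (\<lambda>k::nat. ereal (SUP y. INF x.
      (1 / real k) * (\<Sum>j<k. f ((T ^^ j) x, (S ^^ j) y))))"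

text \<open>Periodic specification property. A specification with n \<ge> 1 pieces is given by
  points x i and integer intervals [a i, b i], i < n (0-indexed).\<close>
definition periodic_spec :: "('a::metric_space \<Rightarrow> 'a) \<Rightarrow> bool" where
  "periodic_spec T \<longleftrightarrow> (\<forall>\<eta>>0. \<exists>D::nat. \<forall>n (x :: nat \<Rightarrow> 'a) (a :: nat \<Rightarrow> int) (b :: nat \<Rightarrow> int).
     (0 < n \<and> (\<forall>i<n. a i \<le> b i) \<and> (\<forall>i. Suc i < n \<longrightarrow> b i < a (Suc i))
       \<and> (\<forall>i. Suc i < n \<longrightarrow> a (Suc i) - b i \<ge> int D))
     \<longrightarrow> (\<exists>x'. (\<forall>i<n. \<forall>j\<in>{a i..b i}. dist (iter T j x') (iter T j (x i)) < \<eta>)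
              \<and> (T ^^ nat (b (n - 1) - a 0 + int D)) x' = x'))"

end

theory Submission
  imports Defs
begin

text \<open>For an invariant measure \<open>\<nu>\<close> on \<open>Y\<close>, choose for each \<open>n\<close> a Borel map \<open>u\<close> such that
  \<open>u y\<close> almost minimises the Birkhoff average of length \<open>n\<close> over the fibre of \<open>y\<close>, and average
  the image of \<open>\<nu>\<close> under \<open>y \<mapsto> (u y, y)\<close> along its orbit of length \<open>n\<close>. These averages
  project to \<open>\<nu>\<close> and their \<open>f\<close>-integrals are at most the \<open>n\<close>-th term of the limit superior,
  up to an error tending to \<open>0\<close>; a weak limit is an invariant lift of \<open>\<nu>\<close> witnessing
  \<open>\<psi>\<^sub>f(\<nu>) \<le> \<delta>(f)\<close>. Specification plays no role in this direction.

  Conversely, specification replaces a point \<open>y\<close> whose minimal average of length \<open>k\<close> is close to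
  \<open>\<delta>(f)\<close> by a periodic point of period \<open>k + D\<close> tracing it. Every invariant lift of
  the measure on that periodic orbit integrates \<open>f\<close> to at least the minimal average over one
  period.\<close>

section \<open>Coding a compact metric space by real numbers\<close>

text \<open>Enumerates the union of finite nets of mesh \<open>1 / real (Suc m)\<close>. A single
  finite net serves all points at once, so \<open>N\<close> depends on \<epsilon> only; this
  uniformity is stronger than mere density of the sequence.\<close>

lemma compact_uniformly_dense_sequence:
  assumes "compact (UNIV :: 'a::metric_space set)"
  obtains e :: "nat \<Rightarrow> 'a::metric_space" where "\<And>\<epsilon>. \<epsilon> > 0 \<Longrightarrow> \<exists>N. \<forall>z. \<exists>i<N. dist (e i) z < \<epsilon>"
proof -
  have "\<exists>F. finite F \<and> (\<forall>z::'a. \<exists>x\<in>F. dist x z < 1 / real (Suc m))" for m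
  proof -
    obtain F where "finite F" "UNIV \<subseteq> (\<Union>x\<in>F. ball x (1 / real (Suc m)) :: 'a set)"
      using compactE_image[OF assms, of UNIV "\<lambda>x. ball x (1 / real (Suc m))"]
      by (metis (no_types, lifting) UNIV_I UN_I centre_in_ball open_ball subsetI
          of_nat_0_less_iff zero_less_Suc zero_less_divide_1_iff)
    then show ?thesis by (force intro: exI[of _ F])
  qed
  then obtain F where F: "\<And>m. finite (F m)" "\<And>m z. \<exists>x\<in>F m. dist (x::'a) z < 1 / real (Suc m)"
    by metis
  define e where "e = from_nat_into (\<Union>m. F m)"
  have cnt: "countable (\<Union>m. F m)"
    using F(1) by (auto intro: countable_finite)
  show ?thesis
  proof
    fix \<epsilon> :: real assume "\<epsilon> > 0"
    then obtain m where m: "1 / real (Suc m) < \<epsilon>"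
      using nat_approx_posE by blast
    let ?i = "\<lambda>x. to_nat_on (\<Union>m. F m) x"
    have "\<exists>i<Suc (Max (?i ` F m)). dist (e i) z < \<epsilon>" for z
    proof -
      obtain x where x: "x \<in> F m" "dist x z < 1 / real (Suc m)" using F(2) by blast
      then have "x \<in> (\<Union>m. F m)" by blast
      then have "e (?i x) = x" unfolding e_def
        by (rule from_nat_into_to_nat_on[OF cnt])
      then have "dist (e (?i x)) z < \<epsilon>" using x(2) m by simp
      moreover have "?i x < Suc (Max (?i ` F m))"
        using x(1) F(1) by (simp add: less_Suc_eq_le)
      ultimately show ?thesis by blast
    qed
    then show "\<exists>N. \<forall>z. \<exists>i<N. dist (e i) z < \<epsilon>" by blast
  qed
qed

text \<open>The point of a rescaled Cantor set with address \<open>a\<close>. Base 3 with digits 0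
  and 1 only, instead of base 2, leaves gaps between cylinders, so that every digit can be read off
  from an approximate value.\<close>

definition ternary :: "(nat \<Rightarrow> bool) \<Rightarrow> real" where
  "ternary a = (\<Sum>k. of_bool (a k) / 3 ^ k)"

lemma summable_inverse_power_3: "summable (\<lambda>k. 1 / 3 ^ k :: real)"
  using summable_geometric[of "1 / 3 :: real"] by (simp add: power_one_over)

lemma summable_ternary: "summable (\<lambda>k. of_bool (a k) / 3 ^ k :: real)"
  by (rule summable_comparison_test[OF _ summable_inverse_power_3]) (auto simp: divide_simps)

lemma ternary_bounds: "0 \<le> ternary a" "ternary a \<le> 3 / 2"
proof -
  show "0 \<le> ternary a" unfolding ternary_def by (rule suminf_nonneg[OF summable_ternary]) auto
  have "ternary a \<le> (\<Sum>k. 1 / 3 ^ k)" unfolding ternary_def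
    by (rule suminf_le[OF _ summable_ternary summable_inverse_power_3]) (auto simp: divide_simps)
  then show "ternary a \<le> 3 / 2"
    using suminf_geometric[of "1 / 3 :: real"] by (simp add: power_one_over)
qed

lemma ternary_shift: "ternary a = of_bool (a 0) + ternary (\<lambda>k. a (Suc k)) / 3"
proof -
  have "(\<Sum>k. of_bool (a (Suc k)) / 3 ^ Suc k) = (\<Sum>k. of_bool (a (Suc k)) / 3 ^ k / (3::real))"
    by (intro suminf_cong) (simp add: field_simps)
  also have "\<dots> = ternary (\<lambda>k. a (Suc k)) / 3"
    unfolding ternary_def by (rule suminf_divide[OF summable_ternary])
  finally show ?thesis
    using suminf_split_head[OF summable_ternary[of a]] by (simp add: ternary_def)
qed

text \<open>All digits after the first contribute at most 1/2, while the first has weight 1; hence a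
  disagreement at digit 0 costs at least 1/2, and every shift divides by 3. The index
  \<open>k\<close> may be any disagreement: an earlier one only gives a larger gap.\<close>

lemma ternary_separation: "a k \<noteq> b k \<Longrightarrow> 1 / (2 * 3 ^ k) \<le> \<bar>ternary a - ternary b\<bar>"
proof (induction k arbitrary: a b)
  case 0
  then show ?case
    using ternary_shift[of a] ternary_shift[of b] ternary_bounds[of "\<lambda>k. a (Suc k)"]
      ternary_bounds[of "\<lambda>k. b (Suc k)"]
    by (cases "a 0"; cases "b 0") auto
next
  case (Suc k)
  have 1: "1 / (2 * 3 ^ Suc k) \<le> (1 / 2 :: real)"
    using one_le_power[of "3::real" "Suc k"] by (simp add: field_simps del: power_Suc)
  show ?case
  proof (cases "a 0 = b 0")
    case True
    then have "\<bar>ternary a - ternary b\<bar> = \<bar>ternary (\<lambda>k. a (Suc k)) - ternary (\<lambda>k. b (Suc k))\<bar> / 3"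
      using ternary_shift[of a] ternary_shift[of b] by (auto simp: abs_if field_simps)
    moreover have "1 / (2 * 3 ^ Suc k) = 1 / (2 * 3 ^ k) / (3 :: real)" by simp
    ultimately show ?thesis
      using Suc.IH[of "\<lambda>k. a (Suc k)" "\<lambda>k. b (Suc k)", OF Suc.prems]
      by (metis divide_right_mono zero_le_numeral)
  next
    case False
    then show ?thesis
      using ternary_shift[of a] ternary_shift[of b] ternary_bounds[of "\<lambda>k. a (Suc k)"]
        ternary_bounds[of "\<lambda>k. b (Suc k)"]
      by (intro order_trans[OF 1]) (cases "a 0"; cases "b 0"; auto)
  qed
qed

text \<open>The digits of \<open>s z\<close> record which balls around a uniformly dense sequence
  contain \<open>z\<close>. Nearby codes agree on the digits of finitely many small balls covering
  the space, so both points lie in a common small ball. Thus \<open>s\<close> is Borel, while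
  uniform continuity is obtained for its inverse.\<close>

lemma compact_borel_coding:
  assumes "compact (UNIV :: 'a::metric_space set)"
  obtains s :: "'a::metric_space \<Rightarrow> real" where "s \<in> borel_measurable borel" "\<And>z. 0 \<le> s z \<and> s z \<le> 3 / 2"
    "\<And>\<epsilon>. \<epsilon> > 0 \<Longrightarrow> \<exists>d>0. \<forall>z w. \<bar>s z - s w\<bar> < d \<longrightarrow> dist z w < \<epsilon>"
proof -
  obtain e :: "nat \<Rightarrow> 'a" where e: "\<And>\<epsilon>. \<epsilon> > 0 \<Longrightarrow> \<exists>N. \<forall>z. \<exists>i<N. dist (e i) z < \<epsilon>"
    using compact_uniformly_dense_sequence[OF assms] by blast
  define U where "U k = (case prod_decode k of (i, m) \<Rightarrow> ball (e i) (1 / real (Suc m)))" for k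
  have U: "open (U k)" for k by (simp add: U_def split: prod.split)
  let ?s = "\<lambda>z. ternary (\<lambda>k. z \<in> U k)"
  show ?thesis
  proof
    have [measurable]: "U k \<in> sets borel" for k using U by simp
    show "?s \<in> borel_measurable borel"
      unfolding ternary_def by measurable
    show "0 \<le> ?s z \<and> ?s z \<le> 3 / 2" for z using ternary_bounds by simp
    fix \<epsilon> :: real assume "\<epsilon> > 0"
    then obtain m where m: "1 / real (Suc m) < \<epsilon> / 2"
      using nat_approx_posE[of "\<epsilon> / 2"] by auto
    obtain N where N: "\<And>z. \<exists>i<N. dist (e i) z < 1 / real (Suc m)"
      using e[of "1 / real (Suc m)"] by auto
    \<comment> \<open>The largest digit index used by the balls of radius
      \<open>1 / real (Suc m)\<close> around the first \<open>N\<close> centres: codes closer than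
      the gap at digit \<open>K\<close> agree on all of them.\<close>
    define K where "K = Max ((\<lambda>i. prod_encode (i, m)) ` {..<N})"
    have K: "prod_encode (i, m) \<le> K" if "i < N" for i
      unfolding K_def using that by simp
    show "\<exists>d>0. \<forall>z w. \<bar>?s z - ?s w\<bar> < d \<longrightarrow> dist z w < \<epsilon>"
    proof (intro exI[of _ "1 / (2 * 3 ^ K)"] conjI allI impI)
      fix z w assume zw: "\<bar>?s z - ?s w\<bar> < 1 / (2 * 3 ^ K)"
      obtain i where i: "i < N" "dist (e i) z < 1 / real (Suc m)" using N by blast
      let ?k = "prod_encode (i, m)"
      have "1 / (2 * 3 ^ K) \<le> 1 / (2 * 3 ^ ?k :: real)"
        using K[OF i(1)] by (simp add: frac_le power_increasing)
      then have "z \<in> U ?k \<longleftrightarrow> w \<in> U ?k"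
        using zw ternary_separation[of "\<lambda>k. z \<in> U k" ?k "\<lambda>k. w \<in> U k"] by linarith
      then have "dist (e i) w < 1 / real (Suc m)" using i by (simp add: U_def)
      then show "dist z w < \<epsilon>" using i m dist_triangle2[of z w "e i"] by (simp add: dist_commute)
    qed simp
  qed
qed

section \<open>Borel probability measures, continuous test functions and weak limits\<close>

lemma integrable_bounded_borel:
  fixes g :: "'a::topological_space \<Rightarrow> real"
  assumes "prob_space M" "sets M = sets borel" "g \<in> borel_measurable borel" "\<And>z. \<bar>g z\<bar> \<le> B"
  shows "integrable M g"
proof -
  interpret prob_space M by fact
  show ?thesis
    using assms(3,4) by (intro integrable_const_bound[of _ B]) (auto simp: measurable_cong_sets[OF assms(2) refl])
qed

lemma abs_integral_le:
  fixes g :: "'a::topological_space \<Rightarrow> real"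
  assumes "prob_space M" "sets M = sets borel" "g \<in> borel_measurable borel" "\<And>z. \<bar>g z\<bar> \<le> B"
  shows "\<bar>integral\<^sup>L M g\<bar> \<le> B"
proof -
  interpret prob_space M by fact
  have "integrable M g" by (rule integrable_bounded_borel[OF assms])
  then have "\<bar>integral\<^sup>L M g\<bar> \<le> (\<integral>z. \<bar>g z\<bar> \<partial>M)" by simp
  also have "\<dots> \<le> (\<integral>z. B \<partial>M)"
    using \<open>integrable M g\<close> assms(4) by (intro integral_mono) auto
  finally show ?thesis by (simp add: prob_space)
qed

lemma compact_continuous_bounded:
  fixes g :: "'a::topological_space \<Rightarrow> real"
  assumes "compact (UNIV :: 'a set)" "continuous_on UNIV g"
  obtains B where "0 \<le> B" "\<And>z. \<bar>g z\<bar> \<le> B"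
proof -
  have "bounded (range g)"
    using compact_continuous_image[OF assms(2,1)] by (rule compact_imp_bounded)
  then obtain B where "\<forall>z. \<bar>g z\<bar> \<le> B" by (auto simp: bounded_iff)
  then show ?thesis by (intro that[of "max B 0"]) (auto simp: le_max_iff_disj)
qed

text \<open>The indicator of a closed set is a pointwise limit of continuous functions with values
  in [0, 1], and the closed sets form an intersection-stable generator of the Borel sets.\<close>

lemma borel_prob_measure_eqI:
  fixes M N :: "'a::metric_space measure"
  assumes "prob_space M" "prob_space N" and sets: "sets M = sets borel" "sets N = sets borel"
    and eq: "\<And>g :: 'a \<Rightarrow> real. continuous_on UNIV g \<Longrightarrow> (\<And>z. 0 \<le> g z \<and> g z \<le> 1) \<Longrightarrow> integral\<^sup>L M g = integral\<^sup>L N g"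
  shows "M = N"
proof -
  interpret M: prob_space M by fact
  interpret N: prob_space N by fact
  have closed_eq: "emeasure M X = emeasure N X" if X: "closed X" for X
  \<comment> \<open>By convention \<open>infdist\<close> to the empty set is 0, so the approximating
    functions below would be constantly 1 there.\<close>
  proof (cases "X = {}")
    case False
    define g where "g n z = max 0 (1 - real n * infdist z X)" for n z
    have lim: "(\<lambda>n. g n z) \<longlonglongrightarrow> indicator X z" for z
    proof (cases "z \<in> X")
      case True
      then show ?thesis by (simp add: g_def)
    next
      case False
      then have pos: "infdist z X > 0"
        using X \<open>X \<noteq> {}\<close> by (simp add: infdist_pos_not_in_closed)
      obtain n0 :: nat where n0: "1 / infdist z X < real n0"
        using reals_Archimedean2 by blast
      have "g n z = 0" if "n \<ge> n0" for n
      proof -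
        have "1 / infdist z X < real n" using n0 that by linarith
        then show ?thesis using pos by (simp add: g_def field_simps)
      qed
      then have "\<forall>\<^sub>F n in sequentially. g n z = 0"
        by (auto simp: eventually_sequentially)
      then show ?thesis using False by (simp add: tendsto_eventually)
    qed
    have cont: "continuous_on UNIV (g n)" for n
      unfolding g_def by (intro continuous_intros)
    have bd: "0 \<le> g n z \<and> g n z \<le> 1" for n z
      by (simp add: g_def infdist_nonneg)
    have int: "(\<lambda>n. integral\<^sup>L P (g n)) \<longlonglongrightarrow> measure P X"
      if P: "prob_space P" "sets P = sets borel" for P
    proof -
      interpret P: prob_space P by fact
      have XP: "X \<in> sets P" using X P by simp
      have "(\<lambda>n. integral\<^sup>L P (g n)) \<longlonglongrightarrow> (\<integral>z. indicator X z \<partial>P)"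
        using lim bd XP P borel_measurable_continuous_onI[OF cont]
        by (intro integral_dominated_convergence[where w="\<lambda>_. 1"])
          (auto simp: measurable_cong_sets[OF P(2) refl])
      then show ?thesis using XP by simp
    qed
    have "measure M X = measure N X"
      using int[OF assms(1) sets(1)] int[OF assms(2) sets(2)] eq[OF cont bd]
      by (simp add: LIMSEQ_unique)
    then show ?thesis by (simp add: M.emeasure_eq_measure N.emeasure_eq_measure)
  qed simp
  show ?thesis
    by (rule measure_eqI_generator_eq[where E="Collect closed" and \<Omega>=UNIV and A="\<lambda>_. UNIV"])
      (use sets closed_eq in \<open>auto simp: Int_stable_def borel_eq_closed closed_Int\<close>)
qed

text \<open>Coding the space by reals with a uniformly continuous inverse reduces this to Helly's
  theorem: the inverse extends continuously to the closure of the set of codes, which carries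
  every weak limit of the coded measures.\<close>

lemma weak_sequential_compactness:
  fixes \<mu> :: "nat \<Rightarrow> 'a::metric_space measure"
  assumes comp: "compact (UNIV :: 'a set)"
    and \<mu>: "\<And>n. prob_space (\<mu> n)" "\<And>n. sets (\<mu> n) = sets borel"
  obtains r M where "strict_mono (r :: nat \<Rightarrow> nat)" "prob_space M" "sets M = sets borel"
    "\<And>g :: 'a \<Rightarrow> real. continuous_on UNIV g \<Longrightarrow> (\<lambda>n. integral\<^sup>L (\<mu> (r n)) g) \<longlonglongrightarrow> integral\<^sup>L M g"
proof -
  obtain s :: "'a \<Rightarrow> real" where s: "s \<in> borel_measurable borel" "\<And>z. 0 \<le> s z \<and> s z \<le> 3 / 2"
    and ucont: "\<And>\<epsilon>. \<epsilon> > 0 \<Longrightarrow> \<exists>d>0. \<forall>z w. \<bar>s z - s w\<bar> < d \<longrightarrow> dist z w < \<epsilon>"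
    using compact_borel_coding[OF comp] by blast
  define C where "C = closure (range s)"
  have C: "closed C" "C \<noteq> {}" "s z \<in> C" for z
    using closure_subset[of "range s"] by (auto simp: C_def)
  \<comment> \<open>Points whose codes tend to \<open>c\<close> have a convergent subsequence by
    compactness; its limit becomes the value at \<open>c\<close> of the extended inverse
    \<open>p\<close>.\<close>
  have "\<exists>z. \<forall>\<epsilon>>0. \<exists>w. dist w z < \<epsilon> \<and> \<bar>s w - c\<bar> < \<epsilon>" if "c \<in> C" for c
  proof -
    obtain u where u: "\<And>n. u n \<in> range s" "u \<longlonglongrightarrow> c"
      using \<open>c \<in> C\<close> unfolding C_def closure_sequential by blast
    have "\<forall>n. \<exists>z. u n = s z" using u(1) by blast
    then obtain w where w: "\<And>n. u n = s (w n)" by metis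
    obtain z :: "'a" and r :: "nat \<Rightarrow> nat" where r: "strict_mono r" "(w \<circ> r) \<longlonglongrightarrow> z"
      using comp unfolding compact_eq_seq_compact_metric 
      by (rule seq_compactE[where f=w]) auto
    have "(u \<circ> r) \<longlonglongrightarrow> c" using u(2) r(1) by (rule LIMSEQ_subseq_LIMSEQ)
    show ?thesis
    proof (rule exI[of _ z], intro allI impI)
      fix \<epsilon> :: real assume "\<epsilon> > 0"
      have "\<forall>\<^sub>F n in sequentially. dist ((w \<circ> r) n) z < \<epsilon> \<and> dist ((u \<circ> r) n) c < \<epsilon>"
        using \<open>(u \<circ> r) \<longlonglongrightarrow> c\<close> r(2) \<open>\<epsilon> > 0\<close> by (intro eventually_conj tendstoD)
      then obtain n where "dist ((w \<circ> r) n) z < \<epsilon> \<and> dist ((u \<circ> r) n) c < \<epsilon>"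
        by (auto simp: eventually_sequentially)
      then show "\<exists>w. dist w z < \<epsilon> \<and> \<bar>s w - c\<bar> < \<epsilon>"
        by (auto simp: w dist_real_def)
    qed
  qed
  then obtain p where p: "\<And>c \<epsilon>. c \<in> C \<Longrightarrow> \<epsilon> > 0 \<Longrightarrow> \<exists>w. dist w (p c) < \<epsilon> \<and> \<bar>s w - c\<bar> < \<epsilon>"
    by metis
  \<comment> \<open>The modulus of the inverse passes to the closure: codes of approximating points
    are within three times \<open>d / 3\<close> of each other, and three distances below
    \<open>\<epsilon> / 3\<close> add up.\<close>
  have p_uc: "\<exists>d>0. \<forall>c\<in>C. \<forall>c'\<in>C. \<bar>c - c'\<bar> < d \<longrightarrow> dist (p c) (p c') < \<epsilon>" if "\<epsilon> > 0" for \<epsilon>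
  proof -
    obtain d where d: "d > 0" "\<And>z w. \<bar>s z - s w\<bar> < d \<Longrightarrow> dist z w < \<epsilon> / 3"
      using ucont[of "\<epsilon> / 3"] \<open>\<epsilon> > 0\<close> by auto
    show ?thesis
    proof (intro exI[of _ "d / 3"] conjI ballI impI)
      fix c c' assume c: "c \<in> C" "c' \<in> C" "\<bar>c - c'\<bar> < d / 3"
      let ?m = "min (d / 3) (\<epsilon> / 3)"
      have "?m > 0" using d(1) \<open>\<epsilon> > 0\<close> by simp
      obtain w where w: "dist w (p c) < ?m" "\<bar>s w - c\<bar> < ?m" using p[OF c(1) \<open>?m > 0\<close>] by blast
      obtain w' where w': "dist w' (p c') < ?m" "\<bar>s w' - c'\<bar> < ?m" using p[OF c(2) \<open>?m > 0\<close>] by blast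
      have "\<bar>s w - s w'\<bar> < d" using w(2) w'(2) c(3) by (simp only: min_less_iff_conj) linarith
      then have "dist w w' < \<epsilon> / 3" by (rule d(2))
      moreover have "dist (p c) (p c') \<le> dist w (p c) + dist w w' + dist w' (p c')"
        by (smt (verit) dist_triangle dist_commute)
      ultimately show "dist (p c) (p c') < \<epsilon>" using w(1) w'(1) by simp
    qed (use d in simp)
  qed
  have p_cont: "continuous_on C p"
    unfolding continuous_on_iff
  proof (intro ballI allI impI)
    fix c \<epsilon> assume "c \<in> C" "(0::real) < \<epsilon>"
    then show "\<exists>d>0. \<forall>c'\<in>C. dist c' c < d \<longrightarrow> dist (p c') (p c) < \<epsilon>"
      using p_uc[OF \<open>0 < \<epsilon>\<close>] unfolding dist_real_def by metis
  qed
  \<comment> \<open>A point \<open>w\<close> near \<open>p (s z)\<close> with code near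
    \<open>s z\<close> is also near \<open>z\<close>, by uniform continuity of the inverse.\<close>
  have p_s: "p (s z) = z" for z
  proof (rule ccontr)
    assume "p (s z) \<noteq> z"
    then have pos: "dist (p (s z)) z > 0" (is "?e > 0") by simp
    obtain d where d: "d > 0" "\<And>z w. \<bar>s z - s w\<bar> < d \<Longrightarrow> dist z w < ?e / 2"
      using ucont[of "?e / 2"] pos by auto
    obtain w where w: "dist w (p (s z)) < min d (?e / 2)" "\<bar>s w - s z\<bar> < min d (?e / 2)"
      using p[OF C(3), of "min d (?e / 2)"] d(1) pos by auto
    then have "dist w z < ?e / 2" using d(2)[of w z] by simp
    then show False using w(1) dist_triangle3[of "p (s z)" z w] by simp
  qed
  have s_meas: "s \<in> borel_measurable (\<mu> n)" for n
    using s(1) by (simp add: measurable_cong_sets[OF \<mu>(2) refl])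
  define \<nu> where "\<nu> n = distr (\<mu> n) borel s" for n
  have \<nu>: "real_distribution (\<nu> n)" for n
    unfolding \<nu>_def using \<mu>(1) s_meas by (rule prob_space.real_distribution_distr)
  \<comment> \<open>All codes lie in [0, 3/2], so one bounded interval carries every coded measure
    and tightness is immediate.\<close>
  have "measure (\<nu> n) {-1<..2} = 1" for n
  proof -
    have "s -` {-1<..2} \<inter> space (\<mu> n) = space (\<mu> n)"
    proof -
      have "- 1 < s z \<and> s z \<le> 2" for z using s(2)[of z] by linarith
      then show ?thesis by auto
    qed
    then show ?thesis
      using \<mu>(1) s_meas by (simp add: \<nu>_def measure_distr prob_space.prob_space)
  qed
  then have "tight \<nu>"
    unfolding tight_def using \<nu> by (intro conjI allI impI exI[of _ "-1"] exI[of _ 2]) auto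
  then obtain r N where r: "strict_mono r" and N: "real_distribution N"
    and conv: "weak_conv_m (\<nu> \<circ> id \<circ> r) N"
    using tight_imp_convergent_subsubsequence[of \<nu> id] strict_mono_id by blast
  interpret N: real_distribution N by fact
  have lim: "(\<lambda>n. integral\<^sup>L (\<mu> (r n)) (\<lambda>z. h (s z))) \<longlonglongrightarrow> integral\<^sup>L N h"
    if h: "continuous_on UNIV h" "\<And>x. norm (h x) \<le> B" for h :: "real \<Rightarrow> real" and B
  proof -
    have "(\<lambda>n. integral\<^sup>L ((\<nu> \<circ> id \<circ> r) n) h) \<longlonglongrightarrow> integral\<^sup>L N h"
    proof (rule weak_conv_imp_integral_bdd_continuous_conv[OF _ N conv _ h(2)])
      show "real_distribution ((\<nu> \<circ> id \<circ> r) n)" for n using \<nu> by simp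
      show "isCont h x" for x using h(1) by (simp add: continuous_on_eq_continuous_at)
    qed
    moreover have "integral\<^sup>L ((\<nu> \<circ> id \<circ> r) n) h = integral\<^sup>L (\<mu> (r n)) (\<lambda>z. h (s z))" for n
      using s_meas borel_measurable_continuous_onI[OF h(1)] by (simp add: \<nu>_def integral_distr)
    ultimately show ?thesis by simp
  qed
  \<comment> \<open>Truncated distance to \<open>C\<close>: a bounded continuous test function
    vanishing at all codes. Its integral against the limit \<open>N\<close> is therefore 0, which
    puts \<open>N\<close> on \<open>C\<close>.\<close>
  let ?dC = "\<lambda>x. min 1 (infdist x C)"
  have dC_cont: "continuous_on UNIV ?dC" by (intro continuous_intros)
  have "(\<lambda>n. 0) \<longlonglongrightarrow> integral\<^sup>L N ?dC"
    using lim[OF dC_cont, of 1] C(3) by (simp add: infdist_nonneg)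
  then have "integral\<^sup>L N ?dC = 0" by (simp add: LIMSEQ_const_iff)
  moreover have "integrable N ?dC"
    using borel_measurable_continuous_onI[OF dC_cont]
    by (intro N.integrable_const_bound[of _ 1]) (auto simp: infdist_nonneg)
  ultimately have "AE x in N. ?dC x = 0"
    by (subst integral_nonneg_eq_0_iff_AE[symmetric]) (auto simp: infdist_nonneg)
  then have AE_C: "AE x in N. x \<in> C"
  proof (rule AE_mp, intro AE_I2 impI)
    fix x assume "?dC x = 0"
    then have "infdist x C = 0" by (auto simp: min_def split: if_splits)
    then show "x \<in> C" using C by (simp add: in_closed_iff_infdist_zero)
  qed
  \<comment> \<open>Off \<open>C\<close>, which is a null set for \<open>N\<close>, an arbitrary
    constant value keeps the map Borel.\<close>
  define p' where "p' = (\<lambda>x. if x \<in> C then p x else p (s undefined))"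
  have p'_meas: "p' \<in> borel_measurable borel"
    unfolding p'_def using C(1) p_cont by (intro borel_measurable_continuous_on_if) auto
  then have p'_N: "p' \<in> borel_measurable N" by simp
  show ?thesis
  proof
    show "strict_mono r" by fact
    show "prob_space (distr N borel p')" using p'_N by (rule N.prob_space_distr)
    show "sets (distr N borel p') = sets borel" by simp
    fix g :: "'a \<Rightarrow> real" assume g: "continuous_on UNIV g"
    obtain B where B: "0 \<le> B" "\<And>z. \<bar>g z\<bar> \<le> B" using compact_continuous_bounded[OF comp g] by blast
    have "continuous_on C (g \<circ> p)"
      using p_cont g by (intro continuous_on_compose) (auto intro: continuous_on_subset)
    \<comment> \<open>Weak convergence on the line tests functions on all of the reals, so
      \<open>g \<circ> p\<close> is extended from \<open>C\<close> by Tietze. Composing with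
      \<open>s\<close> gives back \<open>g\<close>, since \<open>p\<close> inverts
      \<open>s\<close>.\<close>
    then obtain h where h: "continuous_on UNIV h" "\<And>x. x \<in> C \<Longrightarrow> h x = (g \<circ> p) x" "\<And>x. norm (h x) \<le> B"
      using Tietze[of C "g \<circ> p" UNIV B] C(1) B by auto
    have "(\<lambda>n. integral\<^sup>L (\<mu> (r n)) g) \<longlonglongrightarrow> integral\<^sup>L N h"
      using lim[OF h(1,3)] h(2) C(3) p_s by simp
    also have "integral\<^sup>L N h = integral\<^sup>L N (\<lambda>x. g (p' x))"
    proof (rule integral_cong_AE)
      show "h \<in> borel_measurable N" using borel_measurable_continuous_onI[OF h(1)] by simp
      show "(\<lambda>x. g (p' x)) \<in> borel_measurable N"
        using p'_N borel_measurable_continuous_onI[OF g] by (rule measurable_compose)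
      show "AE x in N. h x = g (p' x)"
        using AE_C by eventually_elim (simp add: h(2) p'_def)
    qed
    also have "\<dots> = integral\<^sup>L (distr N borel p') g"
      using p'_N borel_measurable_continuous_onI[OF g] by (simp add: integral_distr)
    finally show "(\<lambda>n. integral\<^sup>L (\<mu> (r n)) g) \<longlonglongrightarrow> integral\<^sup>L (distr N borel p') g" .
  qed
qed

section \<open>Orbit averages and invariant measures\<close>

text \<open>The mean of the push-forwards of \<open>\<mu>\<close> under the first \<open>n\<close>
  iterates, written as the law of a uniformly random iterate of a \<open>\<mu>\<close>-random point;
  Fubini then evaluates integrals. It is meaningful for \<open>0 < n\<close>, as
  \<open>pmf_of_set\<close> is unspecified on the empty set.\<close>

definition orbit_average :: "nat \<Rightarrow> ('a::topological_space \<Rightarrow> 'a) \<Rightarrow> 'a measure \<Rightarrow> 'a measure" where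
  "orbit_average n R \<mu> = distr (measure_pmf (pmf_of_set {..<n}) \<Otimes>\<^sub>M \<mu>) borel (\<lambda>(j, z). (R ^^ j) z)"

lemma continuous_on_funpow:
  fixes R :: "'a::topological_space \<Rightarrow> 'a"
  assumes "continuous_on UNIV R"
  shows "continuous_on UNIV (R ^^ n)"
proof (induction n)
  case (Suc n)
  then show ?case
    using continuous_on_compose[OF Suc continuous_on_subset[OF assms subset_UNIV]] by (simp add: comp_def)
qed (simp add: id_def)

lemma measurable_orbit_map:
  fixes R :: "'a::topological_space \<Rightarrow> 'a"
  assumes "continuous_on UNIV R" "sets \<mu> = sets borel"
  shows "(\<lambda>(j, z). (R ^^ j) z) \<in> borel_measurable (measure_pmf P \<Otimes>\<^sub>M \<mu>)"
proof -
  have "(\<lambda>(j, z). (R ^^ j) z) \<in> borel_measurable (count_space UNIV \<Otimes>\<^sub>M borel)"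
    by (rule measurable_pair_measure_countable1)
      (simp_all add: borel_measurable_continuous_onI continuous_on_funpow[OF assms(1)])
  moreover have "sets (measure_pmf P \<Otimes>\<^sub>M \<mu>) = sets (count_space UNIV \<Otimes>\<^sub>M borel)"
    using assms(2) by (intro sets_pair_measure_cong) auto
  ultimately show ?thesis by (simp cong: measurable_cong_sets)
qed

lemma orbit_average_prob:
  fixes R :: "'a::topological_space \<Rightarrow> 'a"
  assumes "continuous_on UNIV R" "prob_space \<mu>" "sets \<mu> = sets borel"
  shows "prob_space (orbit_average n R \<mu>)" "sets (orbit_average n R \<mu>) = sets borel"
  unfolding orbit_average_def
  by (intro prob_space.prob_space_distr prob_space_pair prob_space_measure_pmf assms
      measurable_orbit_map) simp

lemma integral_orbit_average:
  fixes R :: "'a::topological_space \<Rightarrow> 'a" and g :: "'a \<Rightarrow> real"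
  assumes R: "continuous_on UNIV R" and \<mu>: "prob_space \<mu>" "sets \<mu> = sets borel" and "0 < n"
    and g: "g \<in> borel_measurable borel" "\<And>z. \<bar>g z\<bar> \<le> B"
  shows "integral\<^sup>L (orbit_average n R \<mu>) g = (\<Sum>j<n. \<integral>z. g ((R ^^ j) z) \<partial>\<mu>) / real n"
proof -
  let ?P = "measure_pmf (pmf_of_set {..<n})"
  interpret \<mu>: prob_space \<mu> by fact
  interpret pair_prob_space ?P \<mu> by unfold_locales
  note meas = measurable_orbit_map[OF R \<mu>(2), of "pmf_of_set {..<n}"]
  have "integral\<^sup>L (orbit_average n R \<mu>) g = (\<integral>w. g (case w of (j, z) \<Rightarrow> (R ^^ j) z) \<partial>(?P \<Otimes>\<^sub>M \<mu>))"
    unfolding orbit_average_def by (rule integral_distr[OF meas g(1)])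
  also have "\<dots> = (\<integral>j. (\<integral>z. g ((R ^^ j) z) \<partial>\<mu>) \<partial>?P)"
  proof -
    have "integrable (?P \<Otimes>\<^sub>M \<mu>) (\<lambda>w. g (case w of (j, z) \<Rightarrow> (R ^^ j) z))"
      using measurable_compose[OF meas g(1)] g(2) by (intro P.integrable_const_bound[of _ B]) auto
    from integral_fst'[OF this] show ?thesis by simp
  qed
  also have "\<dots> = (\<Sum>j<n. \<integral>z. g ((R ^^ j) z) \<partial>\<mu>) / real n"
    using \<open>0 < n\<close> by (subst integral_pmf_of_set) (auto simp: lessThan_empty_iff)
  finally show ?thesis .
qed

lemma inv_measuresD:
  assumes "M \<in> inv_measures R"
  shows "prob_space M" "sets M = sets borel" "distr M borel R = M"
  using assms by (auto simp: inv_measures_def)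

text \<open>Shifting the window by one step telescopes, leaving only the two end terms. For bounded
  \<open>g\<close> the defect of invariance is thus of order \<open>1 / n\<close>.\<close>

lemma integral_orbit_average_shift:
  fixes R :: "'a::topological_space \<Rightarrow> 'a" and g :: "'a \<Rightarrow> real"
  assumes R: "continuous_on UNIV R" and \<mu>: "prob_space \<mu>" "sets \<mu> = sets borel" and "0 < n"
    and g: "continuous_on UNIV g" "\<And>z. \<bar>g z\<bar> \<le> B"
  shows "(\<integral>z. g (R z) \<partial>orbit_average n R \<mu>) =
    integral\<^sup>L (orbit_average n R \<mu>) g + ((\<integral>z. g ((R ^^ n) z) \<partial>\<mu>) - integral\<^sup>L \<mu> g) / real n"
proof -
  have cont: "continuous_on UNIV (\<lambda>z. g ((R ^^ j) z))" for j
    using continuous_on_compose2[OF g(1) continuous_on_funpow[OF R]] by simp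
  have int: "integrable \<mu> (\<lambda>z. g ((R ^^ j) z))" for j
    using integrable_bounded_borel[OF \<mu> borel_measurable_continuous_onI[OF cont]] g(2) .
  have "(\<integral>z. g (R z) \<partial>orbit_average n R \<mu>) = (\<Sum>j<n. \<integral>z. g (R ((R ^^ j) z)) \<partial>\<mu>) / real n"
    using cont[of 1] by (intro integral_orbit_average[OF R \<mu> \<open>0 < n\<close> borel_measurable_continuous_onI]) (auto intro: g)
  also have "(\<Sum>j<n. \<integral>z. g (R ((R ^^ j) z)) \<partial>\<mu>) = (\<Sum>j<n. \<integral>z. g ((R ^^ Suc j) z) \<partial>\<mu>)" by simp
  also have "\<dots> = (\<Sum>j<n. \<integral>z. g ((R ^^ j) z) \<partial>\<mu>) + ((\<integral>z. g ((R ^^ n) z) \<partial>\<mu>) - integral\<^sup>L \<mu> g)"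
    using sum_lessThan_telescope[of "\<lambda>j. \<integral>z. g ((R ^^ j) z) \<partial>\<mu>" n] by (simp add: sum_subtractf)
  finally show ?thesis
    using integral_orbit_average[OF R \<mu> \<open>0 < n\<close> borel_measurable_continuous_onI[OF g(1)] g(2)]
    by (simp add: add_divide_distrib)
qed

text \<open>Continuous test functions determine a Borel probability measure, so invariance may be
  checked on them alone, in a form that survives weak limits.\<close>

lemma inv_measuresI:
  fixes R :: "'a::metric_space \<Rightarrow> 'a"
  assumes R: "continuous_on UNIV R" and M: "prob_space M" "sets M = sets borel"
    and eq: "\<And>g :: 'a \<Rightarrow> real. continuous_on UNIV g \<Longrightarrow> (\<And>z. \<bar>g z\<bar> \<le> 1) \<Longrightarrow> (\<integral>z. g (R z) \<partial>M) = integral\<^sup>L M g"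
  shows "M \<in> inv_measures R"
proof -
  have meas: "R \<in> borel_measurable M"
    using borel_measurable_continuous_onI[OF R] by (simp add: measurable_cong_sets[OF M(2) refl])
  have "distr M borel R = M"
  proof (rule borel_prob_measure_eqI)
    fix g :: "'a \<Rightarrow> real" assume g: "continuous_on UNIV g" "\<And>z. 0 \<le> g z \<and> g z \<le> 1"
    then have "integral\<^sup>L (distr M borel R) g = (\<integral>z. g (R z) \<partial>M)"
      by (intro integral_distr meas borel_measurable_continuous_onI)
    also have "\<dots> = integral\<^sup>L M g" using g by (intro eq) auto
    finally show "integral\<^sup>L (distr M borel R) g = integral\<^sup>L M g" .
  qed (use M meas prob_space.prob_space_distr in auto)
  then show ?thesis using M by (simp add: inv_measures_def)
qed

text \<open>The Krylov-Bogolyubov argument, with an initial measure that may change with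
  \<open>n\<close>: bounding the end terms in the shift identity needs no relation between the
  measures. Length \<open>Suc (r n)\<close> excludes empty averages.\<close>

lemma orbit_averages_converge_to_invariant:
  fixes R :: "'a::metric_space \<Rightarrow> 'a"
  assumes comp: "compact (UNIV :: 'a set)" and R: "continuous_on UNIV R"
    and \<mu>: "\<And>n. prob_space (\<mu> n)" "\<And>n. sets (\<mu> n) = sets borel"
  obtains r M where "strict_mono (r :: nat \<Rightarrow> nat)" "M \<in> inv_measures R"
    "\<And>g :: 'a \<Rightarrow> real. continuous_on UNIV g \<Longrightarrow>
      (\<lambda>n. integral\<^sup>L (orbit_average (Suc (r n)) R (\<mu> (r n))) g) \<longlonglongrightarrow> integral\<^sup>L M g"
proof -
  note avg = orbit_average_prob[OF R \<mu>]
  obtain r M where r: "strict_mono (r :: nat \<Rightarrow> nat)" and M: "prob_space M" "sets M = sets borel"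
    and lim: "\<And>g :: 'a \<Rightarrow> real. continuous_on UNIV g \<Longrightarrow>
      (\<lambda>n. integral\<^sup>L (orbit_average (Suc (r n)) R (\<mu> (r n))) g) \<longlonglongrightarrow> integral\<^sup>L M g"
    using weak_sequential_compactness[OF comp, of "\<lambda>n. orbit_average (Suc n) R (\<mu> n)"] avg by blast
  have "M \<in> inv_measures R"
  proof (rule inv_measuresI[OF R M])
    fix g :: "'a \<Rightarrow> real" assume g: "continuous_on UNIV g" "\<And>z. \<bar>g z\<bar> \<le> 1"
    let ?L = "\<lambda>n. orbit_average (Suc (r n)) R (\<mu> (r n))"
    let ?d = "\<lambda>n. ((\<integral>z. g ((R ^^ Suc (r n)) z) \<partial>\<mu> (r n)) - integral\<^sup>L (\<mu> (r n)) g) / real (Suc (r n))"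
    have cont: "continuous_on UNIV (\<lambda>z. g ((R ^^ j) z))" for j
      using continuous_on_compose2[OF g(1) continuous_on_funpow[OF R]] by simp
    have le1: "\<bar>\<integral>z. g ((R ^^ j) z) \<partial>\<mu> n\<bar> \<le> 1" for j n
      using abs_integral_le[OF \<mu> borel_measurable_continuous_onI[OF cont]] g(2) .
    have bound: "\<bar>?d n\<bar> \<le> 2 / real (Suc (r n))" for n
    proof -
      have "\<bar>(\<integral>z. g ((R ^^ Suc (r n)) z) \<partial>\<mu> (r n)) - integral\<^sup>L (\<mu> (r n)) g\<bar> \<le> 2"
        using le1[of "r n" "Suc (r n)"] le1[of "r n" 0] unfolding funpow_0 by linarith
      then show ?thesis by (simp add: divide_right_mono)
    qed
    have "(\<lambda>n. 2 / real (Suc (r n))) \<longlonglongrightarrow> 0"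
      using LIMSEQ_subseq_LIMSEQ[OF LIMSEQ_Suc[OF lim_const_over_n[of "2::real"]] r] by (simp add: comp_def)
    then have "?d \<longlonglongrightarrow> 0"
      by (rule Lim_null_comparison[rotated]) (use bound in auto)
    then have "(\<lambda>n. integral\<^sup>L (?L n) g + ?d n) \<longlonglongrightarrow> integral\<^sup>L M g + 0"
      by (rule tendsto_add[OF lim[OF g(1)]])
    moreover have "integral\<^sup>L (?L n) g + ?d n = (\<integral>z. g (R z) \<partial>?L n)" for n
      by (rule integral_orbit_average_shift[OF R \<mu> _ g, symmetric]) simp
    ultimately have "(\<lambda>n. \<integral>z. g (R z) \<partial>?L n) \<longlonglongrightarrow> integral\<^sup>L M g" by simp
    with lim[OF cont[of 1]] show "(\<integral>z. g (R z) \<partial>M) = integral\<^sup>L M g"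
      by (simp add: LIMSEQ_unique)
  qed
  then show ?thesis using that r lim by blast
qed

section \<open>The product system and invariant lifts with small integral\<close>

lemma funpow_product_map:
  fixes T :: "'a \<Rightarrow> 'a" and S :: "'b \<Rightarrow> 'b"
  shows "((\<lambda>(x, y). (T x, S y)) ^^ j) (x, y) = ((T ^^ j) x, (S ^^ j) y)"
  by (induction j) auto

lemma continuous_on_product_map:
  assumes "continuous_on UNIV T" "continuous_on UNIV S"
  shows "continuous_on UNIV (\<lambda>(x, y). (T x, S y))"
  unfolding case_prod_beta
  by (intro continuous_on_Pair continuous_on_compose2[OF assms(1)] continuous_on_compose2[OF assms(2)]
      continuous_intros) auto

lemma compact_UNIV_prod:
  assumes "compact (UNIV :: 'a::topological_space set)" "compact (UNIV :: 'b::topological_space set)"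
  shows "compact (UNIV :: ('a \<times> 'b) set)"
  using compact_Times[OF assms] by simp

lemma cINF_bounds:
  fixes g :: "'a \<Rightarrow> real"
  assumes "\<And>x. \<bar>g x\<bar> \<le> B"
  shows "\<bar>INF x. g x\<bar> \<le> B"
proof -
  have bdd: "bdd_below (range g)" using assms by (auto intro!: bdd_belowI2[of _ "- B"] simp: abs_le_iff minus_le_iff)
  have "(INF x. g x) \<le> g undefined" using bdd by (rule cINF_lower) simp
  moreover have "- B \<le> (INF x. g x)" using assms by (intro cINF_greatest) (auto simp: abs_le_iff minus_le_iff)
  ultimately show ?thesis using assms[of undefined] by (auto simp: abs_le_iff)
qed

text \<open>Strict sublevel sets in the fibre are open and nonempty, so they meet the dense
  sequence. Choosing the first index that works gives a countably valued selection, which is Borel.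
  The result is packaged as a section \<open>v\<close> of the projection to the base.\<close>

lemma borel_near_minimizer:
  fixes F :: "'a::metric_space \<times> 'b::topological_space \<Rightarrow> real"
  assumes comp: "compact (UNIV :: 'a set)" and F: "continuous_on UNIV F"
    and bd: "\<And>w. \<bar>F w\<bar> \<le> B" and "\<epsilon> > 0"
  obtains v where "v \<in> borel_measurable borel"
    "\<And>y. snd (v y) = y" "\<And>y. F (v y) \<le> (SUP y. INF x. F (x, y)) + \<epsilon>"
proof -
  obtain e :: "nat \<Rightarrow> 'a" where e: "\<And>\<epsilon>. \<epsilon> > 0 \<Longrightarrow> \<exists>N. \<forall>z. \<exists>i<N. dist (e i) z < \<epsilon>"
    using compact_uniformly_dense_sequence[OF comp] by blast
  let ?A = "SUP y. INF x. F (x, y)"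
  let ?P = "\<lambda>i y. F (e i, y) < ?A + \<epsilon>"
  have F1: "continuous_on UNIV (\<lambda>x. F (x, y))" for y
    by (rule continuous_on_compose2[OF F]) (auto intro!: continuous_intros)
  have F2: "continuous_on UNIV (\<lambda>y. F (x, y))" for x
    by (rule continuous_on_compose2[OF F]) (auto intro!: continuous_intros)
  have ex: "\<exists>i. ?P i y" for y
  proof -
    have bdd: "bdd_above (range (\<lambda>y. INF x. F (x, y)))"
      using cINF_bounds[of "\<lambda>x. F (x, _)", OF bd] by (intro bdd_aboveI2[of _ _ B]) (auto simp: abs_le_iff)
    have "(INF x. F (x, y)) \<le> ?A" using bdd by (rule cSUP_upper[rotated]) simp
    then have "(INF x. F (x, y)) < ?A + \<epsilon>" using \<open>\<epsilon> > 0\<close> by simp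
    then obtain x where "F (x, y) < ?A + \<epsilon>"
      using cINF_greatest[of UNIV "?A + \<epsilon>" "\<lambda>x. F (x, y)"] by (meson UNIV_not_empty not_le)
    moreover have "open {x. F (x, y) < ?A + \<epsilon>}"
      by (intro open_Collect_less F1 continuous_intros)
    ultimately obtain d where d: "d > 0" "ball x d \<subseteq> {x. F (x, y) < ?A + \<epsilon>}"
      by (auto simp: open_contains_ball)
    obtain i where "dist (e i) x < d" using e[OF d(1)] by blast
    then show ?thesis using d(2) by (auto simp: dist_commute subset_iff)
  qed
  define k where "k y = (LEAST i. ?P i y)" for y
  have k: "?P (k y) y" for y unfolding k_def by (rule LeastI_ex[OF ex])
  have "Measurable.pred borel (?P i)" for i
  proof -
    have [measurable]: "(\<lambda>y. F (e i, y)) \<in> borel_measurable borel"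
      by (rule borel_measurable_continuous_onI[OF F2])
    show ?thesis by measurable
  qed
  then have k_meas: "k \<in> measurable borel (count_space UNIV)"
    unfolding k_def by (rule measurable_Least)
  show ?thesis
  proof
    show "(\<lambda>y. (e (k y), y)) \<in> borel_measurable borel"
      by (rule measurable_compose_countable[OF _ k_meas])
        (auto intro!: borel_measurable_continuous_onI continuous_intros)
    show "F (e (k y), y) \<le> ?A + \<epsilon>" for y using k[of y] by simp
  qed simp
qed

lemma integral_inv_measures:
  fixes g :: "'a::topological_space \<Rightarrow> real"
  assumes M: "M \<in> inv_measures R" and R: "continuous_on UNIV R" and g: "g \<in> borel_measurable borel"
  shows "(\<integral>z. g ((R ^^ j) z) \<partial>M) = integral\<^sup>L M g"
proof (induction j)
  case (Suc j)
  have sets: "sets M = sets borel" using M by (rule inv_measuresD)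
  have meas: "(\<lambda>z. g ((R ^^ j) z)) \<in> borel_measurable borel"
    using measurable_compose[OF borel_measurable_continuous_onI[OF continuous_on_funpow[OF R]] g] .
  have "integral\<^sup>L M (\<lambda>z. g ((R ^^ j) z)) = integral\<^sup>L (distr M borel R) (\<lambda>z. g ((R ^^ j) z))"
    using inv_measuresD(3)[OF M] by simp
  also have "\<dots> = (\<integral>z. g ((R ^^ j) (R z)) \<partial>M)"
    using meas borel_measurable_continuous_onI[OF R]
    by (intro integral_distr) (auto simp: measurable_cong_sets[OF sets refl])
  finally show ?case using Suc by (simp add: funpow_swap1)
qed simp

text \<open>Serves twice: it bounds \<open>psi\<close> from above, and with \<open>c\<close> large
  it shows that every invariant measure on the base has an invariant lift.\<close>

lemma invariant_lift_limsup:
  fixes T :: "'a::metric_space \<Rightarrow> 'a" and S :: "'b::metric_space \<Rightarrow> 'b" and f :: "'a \<times> 'b \<Rightarrow> real"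
  assumes comp: "compact (UNIV :: 'a set)" "compact (UNIV :: 'b set)"
    and T: "continuous_on UNIV T" and S: "continuous_on UNIV S" and f: "continuous_on UNIV f"
    and \<nu>: "\<nu> \<in> inv_measures S" and less: "delta f T S < ereal c"
  obtains L where "L \<in> inv_measures (\<lambda>(x, y). (T x, S y))" "distr L borel snd = \<nu>" "integral\<^sup>L L f \<le> c"
proof -
  let ?R = "\<lambda>(x, y). (T x, S y)"
  define F where "F k w = (1 / real k) * (\<Sum>j<k. f ((?R ^^ j) w))" for k w
  define A where "A k = (SUP y. INF x. F k (x, y))" for k
  have comp': "compact (UNIV :: ('a \<times> 'b) set)" by (rule compact_UNIV_prod[OF comp])
  have R: "continuous_on UNIV ?R" by (rule continuous_on_product_map[OF T S])
  have fR: "continuous_on UNIV (\<lambda>w. f ((?R ^^ j) w))" for j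
    by (rule continuous_on_compose2[OF f continuous_on_funpow[OF R]]) auto
  have F: "continuous_on UNIV (F k)" for k
    unfolding F_def by (intro continuous_intros fR)
  let ?V = "\<lambda>n v. v \<in> borel_measurable borel \<and> (\<forall>y. snd (v y) = y) \<and>
    (\<forall>y. F (Suc n) (v y) \<le> A (Suc n) + 1 / real (Suc n))"
  have "\<forall>n. \<exists>v. ?V n v"
  proof
    fix n
    obtain B where B: "\<And>w. \<bar>F (Suc n) w\<bar> \<le> B"
      using compact_continuous_bounded[OF comp' F] by blast
    obtain v where "v \<in> borel_measurable borel" "\<And>y. snd (v y) = y"
      "\<And>y. F (Suc n) (v y) \<le> A (Suc n) + 1 / real (Suc n)"
      using borel_near_minimizer[OF comp(1) F B, of "1 / real (Suc n)"] unfolding A_def by auto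
    then show "\<exists>v. ?V n v" by blast
  qed
  then have "\<exists>v. \<forall>n. ?V n (v n)" by (rule choice)
  then obtain v where V: "\<forall>n. ?V n (v n)" by (rule exE)
  have v: "v n \<in> borel_measurable borel" "snd (v n y) = y"
    and vF: "F (Suc n) (v n y) \<le> A (Suc n) + 1 / real (Suc n)" for n y
    by (rule conjunct1[OF spec[OF V]], rule spec[OF conjunct1[OF conjunct2[OF spec[OF V]]]],
        rule spec[OF conjunct2[OF conjunct2[OF spec[OF V]]]])
  note \<nu>' = inv_measuresD[OF \<nu>]
  interpret \<nu>: prob_space \<nu> by (rule \<nu>')
  have v_\<nu>: "v n \<in> borel_measurable \<nu>" for n
    using v(1) by (simp add: measurable_cong_sets[OF \<nu>'(2) refl])
  define \<mu> where "\<mu> n = distr \<nu> borel (v n)" for n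
  have \<mu>: "prob_space (\<mu> n)" "sets (\<mu> n) = sets borel" for n
    using \<nu>.prob_space_distr[OF v_\<nu>] by (auto simp: \<mu>_def)
  obtain r M where r: "strict_mono (r :: nat \<Rightarrow> nat)" and M: "M \<in> inv_measures ?R"
    and lim: "\<And>g :: 'a \<times> 'b \<Rightarrow> real. continuous_on UNIV g \<Longrightarrow>
      (\<lambda>n. integral\<^sup>L (orbit_average (Suc (r n)) ?R (\<mu> (r n))) g) \<longlonglongrightarrow> integral\<^sup>L M g"
    by (rule orbit_averages_converge_to_invariant[OF comp' R \<mu>]) (rule that; assumption)
  have avg: "integral\<^sup>L (orbit_average (Suc n) ?R (\<mu> n)) g =
      (\<Sum>j<Suc n. \<integral>y. g ((?R ^^ j) (v n y)) \<partial>\<nu>) / real (Suc n)"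
    if g: "continuous_on UNIV g" for g :: "'a \<times> 'b \<Rightarrow> real" and n
  proof -
    obtain B where B: "\<And>w. \<bar>g w\<bar> \<le> B"
      using compact_continuous_bounded[OF comp' g] by blast
    have gR: "continuous_on UNIV (\<lambda>w. g ((?R ^^ j) w))" for j
      by (rule continuous_on_compose2[OF g continuous_on_funpow[OF R]]) auto
    have "(\<integral>w. g ((?R ^^ j) w) \<partial>\<mu> n) = (\<integral>y. g ((?R ^^ j) (v n y)) \<partial>\<nu>)" for j
      unfolding \<mu>_def by (rule integral_distr[OF v_\<nu> borel_measurable_continuous_onI[OF gR]])
    then show ?thesis
      using integral_orbit_average[OF R \<mu>, of "Suc n" g B] borel_measurable_continuous_onI[OF g] B by simp
  qed
  note M' = inv_measuresD[OF M]
  have snd_M: "snd \<in> borel_measurable M"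
    by (simp add: measurable_cong_sets[OF M'(2) refl] borel_measurable_continuous_onI continuous_on_snd)
  have "distr M borel snd = \<nu>"
  proof (rule borel_prob_measure_eqI)
    fix g :: "'b \<Rightarrow> real" assume g: "continuous_on UNIV g"
    \<comment> \<open>For test functions of the second coordinate the approximating integrals are
      exactly the \<open>\<nu>\<close>-integral, because \<open>v n\<close> is a section and
      \<open>\<nu>\<close> is invariant; so the limit projects to \<open>\<nu>\<close>.\<close>
    have gsnd: "continuous_on UNIV (\<lambda>w :: 'a \<times> 'b. g (snd w))"
      by (rule continuous_on_compose2[OF g]) (auto intro: continuous_intros)
    have "integral\<^sup>L (orbit_average (Suc n) ?R (\<mu> n)) (\<lambda>w. g (snd w)) = integral\<^sup>L \<nu> g" for n
    proof -
      have "snd ((?R ^^ j) (v n y)) = (S ^^ j) y" for j y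
        using v(2)[of n y] by (cases "v n y") (simp add: funpow_product_map)
      then show ?thesis
        using avg[OF gsnd, of n] integral_inv_measures[OF \<nu> S borel_measurable_continuous_onI[OF g]] by simp
    qed
    then have "integral\<^sup>L M (\<lambda>w. g (snd w)) = integral\<^sup>L \<nu> g"
      using lim[OF gsnd] by (simp add: LIMSEQ_const_iff)
    then show "integral\<^sup>L (distr M borel snd) g = integral\<^sup>L \<nu> g"
      using snd_M borel_measurable_continuous_onI[OF g] by (simp add: integral_distr)
  qed (use prob_space.prob_space_distr[OF M'(1) snd_M] \<nu>' in auto)
  moreover have "integral\<^sup>L M f \<le> c"
  proof -
    obtain B where B: "\<And>w. \<bar>f w\<bar> \<le> B" using compact_continuous_bounded[OF comp' f] by blast
    \<comment> \<open>Exchanging sum and integral turns the orbit average into the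
      \<open>\<nu>\<close>-integral of the Birkhoff average \<open>F (Suc n)\<close> along the
      section, where near-minimality applies pointwise.\<close>
    have int_le: "integral\<^sup>L (orbit_average (Suc n) ?R (\<mu> n)) f \<le> A (Suc n) + 1 / real (Suc n)" for n
    proof -
      have int: "integrable \<nu> (\<lambda>y. f ((?R ^^ j) (v n y)))" for j
        using measurable_compose[OF v_\<nu> borel_measurable_continuous_onI[OF fR]] B
        by (intro \<nu>.integrable_const_bound[of _ B]) auto
      have "integral\<^sup>L (orbit_average (Suc n) ?R (\<mu> n)) f = (\<integral>y. F (Suc n) (v n y) \<partial>\<nu>)"
        unfolding avg[OF f] F_def using int by simp
      also have "\<dots> \<le> (\<integral>y. A (Suc n) + 1 / real (Suc n) \<partial>\<nu>)"
        using vF int by (intro integral_mono) (auto simp: F_def)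
      finally show ?thesis by (simp add: \<nu>.prob_space)
    qed
    \<comment> \<open>The strict inequality with \<open>c\<close> forces \<open>A k < c\<close> for
      all large \<open>k\<close>, hence along the subsequence, whose indices satisfy
      \<open>n \<le> r n\<close>.\<close>
    have "delta f T S = limsup (\<lambda>k. ereal (A k))"
      unfolding delta_def A_def F_def funpow_product_map ..
    then have "\<forall>\<^sub>F k in sequentially. ereal (A k) < ereal c"
      using less by (intro Limsup_lessD) simp
    then have "\<forall>\<^sub>F n in sequentially. A (Suc (r n)) < c"
      using r by (simp add: eventually_sequentially) (metis le_SucI order_trans seq_suble)
    then have ev: "\<forall>\<^sub>F n in sequentially. integral\<^sup>L (orbit_average (Suc (r n)) ?R (\<mu> (r n))) f \<le> c + 1 / real (Suc (r n))"
      by eventually_elim (use int_le in \<open>smt (verit)\<close>)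
    have "(\<lambda>n. 1 / real (Suc (r n))) \<longlonglongrightarrow> 0"
      using LIMSEQ_subseq_LIMSEQ[OF LIMSEQ_Suc[OF lim_const_over_n[of "1::real"]] r] by (simp add: comp_def)
    then have "(\<lambda>n. c + 1 / real (Suc (r n))) \<longlonglongrightarrow> c + 0"
      by (intro tendsto_intros)
    then show ?thesis using tendsto_le[OF _ _ lim[OF f] ev] by simp
  qed
  ultimately show ?thesis using M by (intro that)
qed

section \<open>Extrema of real sets, and the bound of \<open>alpha\<close> by
  \<open>delta\<close>\<close>

text \<open>Orbit averages of a point mass have an invariant limit. This makes the set under the
  real-valued \<open>Sup\<close> in \<open>alpha\<close> nonempty.\<close>

lemma inv_measures_nonempty:
  fixes S :: "'b::metric_space \<Rightarrow> 'b"
  assumes "compact (UNIV :: 'b set)" "continuous_on UNIV S"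
  obtains \<nu> where "\<nu> \<in> inv_measures S"
  using orbit_averages_converge_to_invariant[OF assms, of "\<lambda>_. return borel undefined"]
  by (metis prob_space_return sets_return space_borel UNIV_I)

text \<open>A real \<open>Inf\<close> is a lower bound only for sets bounded below; the bound on
  \<open>f\<close> supplies this.\<close>

lemma psi_le:
  fixes f :: "'a::topological_space \<times> 'b::topological_space \<Rightarrow> real"
  assumes f: "f \<in> borel_measurable borel" "\<And>w. \<bar>f w\<bar> \<le> B"
    and L: "L \<in> inv_measures (\<lambda>(x, y). (T x, S y))" "distr L borel snd = \<nu>"
  shows "psi f T S \<nu> \<le> integral\<^sup>L L f"
  unfolding psi_def
proof (rule cInf_lower)
  show "bdd_below {integral\<^sup>L L f |L. L \<in> inv_measures (\<lambda>(x, y). (T x, S y)) \<and> distr L borel snd = \<nu>}"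
  proof (rule bdd_belowI)
    fix r assume "r \<in> {integral\<^sup>L L f |L. L \<in> inv_measures (\<lambda>(x, y). (T x, S y)) \<and> distr L borel snd = \<nu>}"
    then obtain L where "r = integral\<^sup>L L f" "L \<in> inv_measures (\<lambda>(x, y). (T x, S y))" by blast
    then show "- B \<le> r"
      using abs_integral_le[OF inv_measuresD(1,2) f] by (simp add: abs_le_iff minus_le_iff)
  qed
qed (use L in blast)

lemma delta_le_bound:
  fixes f :: "'a \<times> 'b \<Rightarrow> real"
  assumes "\<And>w. \<bar>f w\<bar> \<le> B"
  shows "delta f T S \<le> ereal B"
  unfolding delta_def
proof (rule Limsup_bounded, rule always_eventually, rule allI)
  fix k
  have "\<bar>(1 / real k) * (\<Sum>j<k. f ((T ^^ j) x, (S ^^ j) y))\<bar> \<le> B" for x y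
  \<comment> \<open>For \<open>k = 0\<close> the factor \<open>1 / real k\<close> is 0 by
    convention, and so is the average.\<close>
  proof (cases "k = 0")
    case True
    then show ?thesis using assms[of undefined] by simp
  next
    case False
    have "\<bar>\<Sum>j<k. f ((T ^^ j) x, (S ^^ j) y)\<bar> \<le> real k * B"
      by (rule order_trans[OF sum_abs]) (use sum_bounded_above[of "{..<k}" "\<lambda>j. \<bar>f ((T ^^ j) x, (S ^^ j) y)\<bar>" B] assms in simp)
    then show ?thesis using False by (simp add: abs_mult field_simps)
  qed
  then have "\<bar>INF x. (1 / real k) * (\<Sum>j<k. f ((T ^^ j) x, (S ^^ j) y))\<bar> \<le> B" for y
    by (rule cINF_bounds)
  then show "ereal (SUP y. INF x. (1 / real k) * (\<Sum>j<k. f ((T ^^ j) x, (S ^^ j) y))) \<le> ereal B"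
    unfolding ereal_less_eq by (intro cSUP_least) (auto simp: abs_le_iff)
qed

lemma psi_le_delta:
  fixes T :: "'a::metric_space \<Rightarrow> 'a" and S :: "'b::metric_space \<Rightarrow> 'b" and f :: "'a \<times> 'b \<Rightarrow> real"
  assumes comp: "compact (UNIV :: 'a set)" "compact (UNIV :: 'b set)"
    and T: "continuous_on UNIV T" and S: "continuous_on UNIV S" and f: "continuous_on UNIV f"
    and \<nu>: "\<nu> \<in> inv_measures S" and less: "delta f T S < ereal c"
  shows "psi f T S \<nu> \<le> c"
proof -
  obtain B where B: "\<And>w. \<bar>f w\<bar> \<le> B"
    using compact_continuous_bounded[OF compact_UNIV_prod[OF comp] f] by blast
  obtain L where L: "L \<in> inv_measures (\<lambda>(x, y). (T x, S y))" "distr L borel snd = \<nu>" "integral\<^sup>L L f \<le> c"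
    using invariant_lift_limsup[OF comp T S f \<nu> less] by blast
  show ?thesis
    using psi_le[OF borel_measurable_continuous_onI[OF f] B L(1,2)] L(3) by simp
qed

lemma alpha_le_delta:
  fixes T :: "'a::metric_space \<Rightarrow> 'a" and S :: "'b::metric_space \<Rightarrow> 'b" and f :: "'a \<times> 'b \<Rightarrow> real"
  assumes comp: "compact (UNIV :: 'a set)" "compact (UNIV :: 'b set)"
    and T: "continuous_on UNIV T" and S: "continuous_on UNIV S" and f: "continuous_on UNIV f"
  shows "ereal (alpha f T S) \<le> delta f T S"
proof (rule ccontr)
  assume "\<not> ereal (alpha f T S) \<le> delta f T S"
  then obtain c where c: "delta f T S < ereal c" "ereal c < ereal (alpha f T S)"
    using ereal_dense2 by (metis not_le)
  obtain \<nu> where "\<nu> \<in> inv_measures S" using inv_measures_nonempty[OF comp(2) S] by blast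
  then have "alpha f T S \<le> c"
    unfolding alpha_def using psi_le_delta[OF comp T S f _ c(1)] by (intro cSup_least) auto
  then show False using c(2) by simp
qed

text \<open>The uniform bound \<open>B + 1\<close> on all values of \<open>psi\<close>, obtained
  from the bound on \<open>delta\<close>, ensures that the real \<open>Sup\<close> in
  \<open>alpha\<close> is an upper bound.\<close>

lemma psi_le_alpha:
  fixes T :: "'a::metric_space \<Rightarrow> 'a" and S :: "'b::metric_space \<Rightarrow> 'b" and f :: "'a \<times> 'b \<Rightarrow> real"
  assumes comp: "compact (UNIV :: 'a set)" "compact (UNIV :: 'b set)"
    and T: "continuous_on UNIV T" and S: "continuous_on UNIV S" and f: "continuous_on UNIV f"
    and \<nu>: "\<nu> \<in> inv_measures S"
  shows "psi f T S \<nu> \<le> alpha f T S"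
proof -
  obtain B where B: "\<And>w. \<bar>f w\<bar> \<le> B"
    using compact_continuous_bounded[OF compact_UNIV_prod[OF comp] f] by blast
  have "delta f T S \<le> ereal B" using B by (rule delta_le_bound)
  then have "delta f T S < ereal (B + 1)" by (rule order_le_less_trans) simp
  then have "psi f T S \<nu>' \<le> B + 1" if "\<nu>' \<in> inv_measures S" for \<nu>'
    using psi_le_delta[OF comp T S f that] by blast
  then show ?thesis
    unfolding alpha_def using \<nu> by (intro cSup_upper bdd_aboveI[of _ "B + 1"]) auto
qed

text \<open>Passing a lower bound to a real \<open>Inf\<close> requires a nonempty set: a lift
  exists by \<open>invariant_lift_limsup\<close> applied with \<open>B + 1\<close>, which exceeds
  \<open>delta\<close>.\<close>

lemma psi_ge:
  fixes T :: "'a::metric_space \<Rightarrow> 'a" and S :: "'b::metric_space \<Rightarrow> 'b" and f :: "'a \<times> 'b \<Rightarrow> real"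
  assumes comp: "compact (UNIV :: 'a set)" "compact (UNIV :: 'b set)"
    and T: "continuous_on UNIV T" and S: "continuous_on UNIV S" and f: "continuous_on UNIV f"
    and \<nu>: "\<nu> \<in> inv_measures S"
    and ge: "\<And>L. L \<in> inv_measures (\<lambda>(x, y). (T x, S y)) \<Longrightarrow> distr L borel snd = \<nu> \<Longrightarrow> c \<le> integral\<^sup>L L f"
  shows "c \<le> psi f T S \<nu>"
proof -
  obtain B where B: "\<And>w. \<bar>f w\<bar> \<le> B"
    using compact_continuous_bounded[OF compact_UNIV_prod[OF comp] f] by blast
  have "delta f T S \<le> ereal B" using B by (rule delta_le_bound)
  then have "delta f T S < ereal (B + 1)" by (rule order_le_less_trans) simp
  then obtain L where "L \<in> inv_measures (\<lambda>(x, y). (T x, S y))" "distr L borel snd = \<nu>"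
    using invariant_lift_limsup[OF comp T S f \<nu>] by blast
  then show ?thesis unfolding psi_def using ge by (intro cInf_greatest) auto
qed

section \<open>Measures on periodic orbits and their invariant lifts\<close>

text \<open>Over a full period the two end terms of the shift identity cancel, so the average of a
  point mass is exactly invariant. Here \<open>p\<close> may be any positive period, not only the
  least one.\<close>

lemma periodic_orbit_measure:
  fixes S :: "'b::metric_space \<Rightarrow> 'b"
  assumes S: "continuous_on UNIV S" and per: "(S ^^ p) y = y" and "0 < p"
  defines "\<nu> \<equiv> orbit_average p S (return borel y)"
  shows "\<nu> \<in> inv_measures S" "AE z in \<nu>. \<exists>i<p. z = (S ^^ i) y"
proof -
  have ret: "prob_space (return borel y)" "sets (return borel y) = sets borel"
    by (auto intro: prob_space_return)
  have ret_int: "(\<integral>z. g z \<partial>return borel y) = g y" if "g \<in> borel_measurable borel" for g :: "'b \<Rightarrow> real"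
    using that by (intro integral_return) auto
  have \<nu>: "prob_space \<nu>" "sets \<nu> = sets borel"
    unfolding \<nu>_def using orbit_average_prob[OF S ret] by auto
  show "\<nu> \<in> inv_measures S"
  proof (rule inv_measuresI[OF S \<nu>])
    fix g :: "'b \<Rightarrow> real" assume g: "continuous_on UNIV g" "\<And>z. \<bar>g z\<bar> \<le> 1"
    have "continuous_on UNIV (\<lambda>z. g ((S ^^ p) z))"
      by (rule continuous_on_compose2[OF g(1) continuous_on_funpow[OF S]]) auto
    then show "(\<integral>z. g (S z) \<partial>\<nu>) = integral\<^sup>L \<nu> g"
      unfolding \<nu>_def integral_orbit_average_shift[OF S ret \<open>0 < p\<close> g]
      using per g by (simp add: ret_int borel_measurable_continuous_onI)
  qed
  let ?O = "(\<lambda>i. (S ^^ i) y) ` {..<p}"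
  interpret \<nu>: prob_space \<nu> by fact
  have O: "?O \<in> sets borel" by (intro borel_closed finite_imp_closed) simp
  then have O\<nu>: "?O \<in> sets \<nu>" using \<nu> by simp
  have meas: "(\<lambda>z. indicator ?O ((S ^^ j) z) :: real) \<in> borel_measurable borel" for j
    using measurable_compose[OF borel_measurable_continuous_onI[OF continuous_on_funpow[OF S]]
        borel_measurable_indicator[OF O]] .
  have "integral\<^sup>L \<nu> (indicator ?O) = (\<Sum>j<p. \<integral>z. indicator ?O ((S ^^ j) z) \<partial>return borel y) / real p"
    unfolding \<nu>_def
    by (rule integral_orbit_average[OF S ret \<open>0 < p\<close> borel_measurable_indicator[OF O], of 1])
      (simp add: indicator_def)
  also have "\<dots> = (\<Sum>j<p. indicator ?O ((S ^^ j) y)) / real p"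
    by (simp only: ret_int[OF meas])
  also have "(\<Sum>j<p. indicator ?O ((S ^^ j) y)) = (\<Sum>j<p. 1 :: real)"
    by (intro sum.cong) auto
  finally have "measure \<nu> ?O = 1" using O\<nu> \<open>0 < p\<close> by simp
  then have "AE z in \<nu>. z \<in> ?O" using O\<nu> by (simp add: \<nu>.prob_eq_1)
  then show "AE z in \<nu>. \<exists>i<p. z = (S ^^ i) y" by eventually_elim auto
qed

lemma sum_split_shift:
  fixes a :: "nat \<Rightarrow> 'a::comm_monoid_add"
  shows "(\<Sum>j<m + n. a j) = (\<Sum>j<m. a j) + (\<Sum>j<n. a (m + j))"
  by (induction n) (auto simp: add.assoc)

text \<open>An orbit of the product system over a periodic orbit decomposes into full periods, up to two
  incomplete periods at its ends.\<close>

lemma sum_over_periodic_orbit_ge: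
  fixes T :: "'a \<Rightarrow> 'a" and S :: "'b \<Rightarrow> 'b" and f :: "'a \<times> 'b \<Rightarrow> real"
  assumes per: "(S ^^ p) y = y" and B: "\<And>w. \<bar>f w\<bar> \<le> B" and "i < p"
    and ge: "\<And>x. real p * c \<le> (\<Sum>j<p. f ((T ^^ j) x, (S ^^ j) y))"
  shows "real N * (real p * c) - real p * B \<le> (\<Sum>j<Suc N * p. f ((T ^^ j) x, (S ^^ j) ((S ^^ i) y)))"
proof -
  have per': "(S ^^ (j + p)) y = (S ^^ j) y" for j
    by (simp add: funpow_add per)
  \<comment> \<open>The bound \<open>ge\<close> holds for every starting point over
    \<open>y\<close>, so after one period the induction restarts at \<open>(T ^^ p) x\<close> over
    the same \<open>y\<close>.\<close>
  have blocks: "real N * (real p * c) \<le> (\<Sum>j<N * p. f ((T ^^ j) x, (S ^^ j) y))" for N x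
  proof (induction N arbitrary: x)
    case (Suc N)
    have "(\<Sum>j<Suc N * p. f ((T ^^ j) x, (S ^^ j) y)) = (\<Sum>j<p. f ((T ^^ j) x, (S ^^ j) y))
        + (\<Sum>j<N * p. f ((T ^^ j) ((T ^^ p) x), (S ^^ j) y))"
      using sum_split_shift[of "\<lambda>j. f ((T ^^ j) x, (S ^^ j) y)" p "N * p"]
      by (simp add: per add.commute[of p] funpow_add)
    then show ?case using ge[of x] Suc[of "(T ^^ p) x"] by (simp add: algebra_simps)
  qed simp
  define a where "a j = f ((T ^^ j) x, (S ^^ j) ((S ^^ i) y))" for j
  have a_ge: "- (real n * B) \<le> (\<Sum>j<n. a (m + j))" for m n
    using sum_bounded_below[of "{..<n}" "- B" "\<lambda>j. a (m + j)"] B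
    by (simp add: a_def abs_le_iff minus_le_iff)
  have "a (p - i + j) = f ((T ^^ j) ((T ^^ (p - i)) x), (S ^^ j) y)" for j
  proof -
    have "(S ^^ (p - i + j)) ((S ^^ i) y) = (S ^^ (p - i + j + i)) y" by (simp add: funpow_add)
    also have "p - i + j + i = j + p" using \<open>i < p\<close> by simp
    finally show ?thesis by (simp add: a_def per') (simp add: add.commute[of _ j] funpow_add)
  qed
  then have mid: "real N * (real p * c) \<le> (\<Sum>j<N * p. a (p - i + j))"
    using blocks[of N "(T ^^ (p - i)) x"] by simp
  \<comment> \<open>The first \<open>p - i\<close> steps lead from \<open>(S ^^ i) y\<close> back to
    \<open>y\<close>, then come \<open>N\<close> full periods and \<open>i\<close> leftover steps.
    The two incomplete stretches have \<open>p\<close> terms together and lose at most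
    \<open>real p * B\<close>.\<close>
  have "Suc N * p = (p - i + N * p) + i" using \<open>i < p\<close> by simp
  then have "(\<Sum>j<Suc N * p. a j) = (\<Sum>j<p - i. a j) + (\<Sum>j<N * p. a (p - i + j)) + (\<Sum>j<i. a (p - i + N * p + j))"
    by (simp only: sum_split_shift)
  moreover have "real p * B = real (p - i) * B + real i * B"
    using \<open>i < p\<close> by (simp add: of_nat_diff algebra_simps)
  ultimately have "real N * (real p * c) - real p * B \<le> (\<Sum>j<Suc N * p. a j)"
    using a_ge[of "p - i" 0] a_ge[of i "p - i + N * p"] mid by simp
  then show ?thesis by (simp add: a_def)
qed

text \<open>Almost every point of \<open>L\<close> lies over the orbit, so the pointwise bound on
  long sums can be integrated; invariance turns the integrated sum into a multiple of the integral
  of \<open>f\<close>. The end loss stays bounded as the number of periods grows.\<close>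

lemma integral_over_periodic_orbit_ge:
  fixes T :: "'a::metric_space \<Rightarrow> 'a" and S :: "'b::metric_space \<Rightarrow> 'b" and f :: "'a \<times> 'b \<Rightarrow> real"
  assumes T: "continuous_on UNIV T" and S: "continuous_on UNIV S" and f: "continuous_on UNIV f"
    and B: "\<And>w. \<bar>f w\<bar> \<le> B" and per: "(S ^^ p) y = y" and "0 < p"
    and L: "L \<in> inv_measures (\<lambda>(x, y). (T x, S y))"
    and marginal: "distr L borel snd = orbit_average p S (return borel y)"
    and ge: "\<And>x. real p * c \<le> (\<Sum>j<p. f ((T ^^ j) x, (S ^^ j) y))"
  shows "c \<le> integral\<^sup>L L f"
proof (rule ccontr)
  let ?R = "\<lambda>(x, y). (T x, S y)"
  have R: "continuous_on UNIV ?R" by (rule continuous_on_product_map[OF T S])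
  note L' = inv_measuresD[OF L]
  interpret L: prob_space L by (rule L')
  have "snd \<in> borel_measurable L"
    by (simp add: measurable_cong_sets[OF L'(2) refl] borel_measurable_continuous_onI continuous_on_snd)
  moreover have "AE z in distr L borel snd. \<exists>i<p. z = (S ^^ i) y"
    unfolding marginal by (rule periodic_orbit_measure(2)[OF S per \<open>0 < p\<close>])
  ultimately have AE: "AE w in L. \<exists>i<p. snd w = (S ^^ i) y" by (rule AE_distrD)
  have int: "integrable L (\<lambda>w. f ((?R ^^ j) w))" for j
    using continuous_on_compose2[OF f continuous_on_funpow[OF R]] B
    by (intro integrable_bounded_borel[OF L'(1,2) borel_measurable_continuous_onI, of _ B]) auto
  have main: "real N * c - B \<le> real (Suc N) * integral\<^sup>L L f" for N
  proof -
    have "(\<integral>w. (\<Sum>j<Suc N * p. f ((?R ^^ j) w)) \<partial>L) = real (Suc N * p) * integral\<^sup>L L f"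
      using int integral_inv_measures[OF L R borel_measurable_continuous_onI[OF f]]
      by (simp add: Bochner_Integration.integral_sum)
    moreover have "(\<integral>w. real N * (real p * c) - real p * B \<partial>L) \<le> (\<integral>w. (\<Sum>j<Suc N * p. f ((?R ^^ j) w)) \<partial>L)"
    proof (rule integral_mono_AE)
      show "AE w in L. real N * (real p * c) - real p * B \<le> (\<Sum>j<Suc N * p. f ((?R ^^ j) w))"
        using AE
      proof eventually_elim
        case (elim w)
        then obtain i x where "i < p" and w: "w = (x, (S ^^ i) y)" by (cases w) auto
        show ?case
          unfolding w funpow_product_map
          by (rule sum_over_periodic_orbit_ge[OF per B \<open>i < p\<close> ge])
      qed
    qed (use int in auto)
    ultimately have "real p * (real N * c - B) \<le> real p * (real (Suc N) * integral\<^sup>L L f)"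
      by (simp add: L.prob_space algebra_simps)
    then show ?thesis using \<open>0 < p\<close> by simp
  qed
  assume "\<not> c \<le> integral\<^sup>L L f"
  then have pos: "c - integral\<^sup>L L f > 0" by simp
  \<comment> \<open>Chosen so that \<open>real N * (c - integral)\<close> exceeds
    \<open>B + integral\<close>, which \<open>main\<close> forbids.\<close>
  then obtain N :: nat where "(B + integral\<^sup>L L f) / (c - integral\<^sup>L L f) < real N"
    using reals_Archimedean2 by blast
  then have "B + integral\<^sup>L L f < real N * (c - integral\<^sup>L L f)" using pos by (simp add: field_simps)
  then show False using main[of N] by (simp add: algebra_simps)
qed

section \<open>Periodic tracing and the bound of \<open>delta\<close> by
  \<open>alpha\<close>\<close>

text \<open>A specification with the single piece [0, k], for which the spacing conditions are
  vacuous. The essential point is that \<open>D\<close> is chosen before \<open>y\<close> and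
  \<open>k\<close>.\<close>

lemma periodic_spec_shadowing:
  assumes "periodic_spec S" "\<eta> > 0"
  shows "\<exists>D. \<forall>y k. \<exists>y'. (\<forall>j\<le>k. dist ((S ^^ j) y') ((S ^^ j) y) < \<eta>) \<and> (S ^^ (k + D)) y' = y'"
  using assms(1)[unfolded periodic_spec_def, THEN spec, THEN mp, OF assms(2)]
proof (rule ex_forward, goal_cases)
  case (1 D)
  show ?case
  proof (intro allI)
    fix y k
    obtain y' where y': "\<forall>j\<in>{0..int k}. dist (iter S j y') (iter S j y) < \<eta>"
      and per: "(S ^^ nat (int k - 0 + int D)) y' = y'"
      using 1[THEN spec[of _ 1], THEN spec[of _ "\<lambda>_. y"], THEN spec[of _ "\<lambda>_. 0"], THEN spec[of _ "\<lambda>_. int k"]]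
      by auto
    have "dist ((S ^^ j) y') ((S ^^ j) y) < \<eta>" if "j \<le> k" for j
      using bspec[OF y', of "int j"] that by (simp add: iter_def)
    moreover have "(S ^^ (k + D)) y' = y'"
      using per by (simp flip: of_nat_add)
    ultimately show "\<exists>y'. (\<forall>j\<le>k. dist ((S ^^ j) y') ((S ^^ j) y) < \<eta>) \<and> (S ^^ (k + D)) y' = y'" by blast
  qed
qed

lemma delta_le_alpha:
  fixes T :: "'a::metric_space \<Rightarrow> 'a" and S :: "'b::metric_space \<Rightarrow> 'b" and f :: "'a \<times> 'b \<Rightarrow> real"
  assumes comp: "compact (UNIV :: 'a set)" "compact (UNIV :: 'b set)"
    and T: "continuous_on UNIV T" and S: "continuous_on UNIV S" and f: "continuous_on UNIV f"
    and spec: "periodic_spec S"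
  shows "delta f T S \<le> ereal (alpha f T S)"
proof (rule ccontr)
  assume "\<not> delta f T S \<le> ereal (alpha f T S)"
  then obtain c where c: "ereal (alpha f T S) < ereal c" "ereal c < delta f T S"
    using ereal_dense2 by (metis not_le)
  \<comment> \<open>One third of the gap pays for the tracing error, one for the \<open>D\<close>
    closing steps, and the last keeps \<open>c - 2 * \<epsilon>\<close> strictly above
    \<open>alpha\<close>.\<close>
  define \<epsilon> where "\<epsilon> = (c - alpha f T S) / 3"
  have \<epsilon>: "\<epsilon> > 0" "alpha f T S < c - 2 * \<epsilon>" using c(1) by (auto simp: \<epsilon>_def field_simps)
  have comp': "compact (UNIV :: ('a \<times> 'b) set)" by (rule compact_UNIV_prod[OF comp])
  obtain B where B: "\<And>w. \<bar>f w\<bar> \<le> B" using compact_continuous_bounded[OF comp' f] by blast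
  have "uniformly_continuous_on UNIV f" using f comp' by (rule compact_uniformly_continuous)
  then obtain \<eta> where \<eta>: "\<eta> > 0" "\<And>v w. dist v w < \<eta> \<Longrightarrow> dist (f v) (f w) < \<epsilon>"
    using \<epsilon>(1) unfolding uniformly_continuous_on_def by (metis UNIV_I)
  obtain D where D: "\<And>y k. \<exists>y'. (\<forall>j\<le>k. dist ((S ^^ j) y') ((S ^^ j) y) < \<eta>) \<and> (S ^^ (k + D)) y' = y'"
    using periodic_spec_shadowing[OF spec \<eta>(1)] by blast
  let ?F = "\<lambda>k x y. (1 / real k) * (\<Sum>j<k. f ((T ^^ j) x, (S ^^ j) y))"
  \<comment> \<open>Beyond \<open>K\<close> the gain \<open>real k * \<epsilon>\<close> outweighs
    both the loss \<open>real D * B\<close> on the closing steps and the target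
    \<open>real D * (c - 2 * \<epsilon>)\<close> for them. This is possible because \<open>D\<close>
    is already fixed.\<close>
  obtain K :: nat where K: "(real D * B + real D * (c - 2 * \<epsilon>)) / \<epsilon> < real K"
    using reals_Archimedean2 by blast
  have "\<exists>k\<ge>Suc K. c < (SUP y. INF x. ?F k x y)"
  proof (rule ccontr)
    assume "\<not> ?thesis"
    then have "\<forall>\<^sub>F k in sequentially. ereal (SUP y. INF x. ?F k x y) \<le> ereal c"
      by (auto simp: eventually_sequentially not_less intro!: exI[of _ "Suc K"])
    then have "delta f T S \<le> ereal c" unfolding delta_def by (rule Limsup_bounded)
    then show False using c(2) by simp
  qed
  then obtain k where k: "k \<ge> Suc K" "c < (SUP y. INF x. ?F k x y)" by blast
  then have "k > 0" by simp
  obtain y where y: "c < (INF x. ?F k x y)"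
    using k(2) cSUP_least[of UNIV "\<lambda>y. INF x. ?F k x y" c] by (meson UNIV_not_empty not_le)
  have F_ge: "real k * c \<le> (\<Sum>j<k. f ((T ^^ j) x, (S ^^ j) y))" for x
  proof -
    have "- (real k * B) \<le> (\<Sum>j<k. f ((T ^^ j) x, (S ^^ j) y))" for x
      using sum_bounded_below[of "{..<k}" "- B" "\<lambda>j. f ((T ^^ j) x, (S ^^ j) y)"] B
      by (simp add: abs_le_iff minus_le_iff)
    then have "bdd_below (range (\<lambda>x. ?F k x y))"
      using \<open>k > 0\<close> by (intro bdd_belowI2[of _ "- B"]) (simp add: field_simps)
    then have "(INF x. ?F k x y) \<le> ?F k x y" by (rule cINF_lower) simp
    with y have "c < ?F k x y" by (rule less_le_trans)
    then show ?thesis using \<open>k > 0\<close> by (simp add: field_simps)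
  qed
  obtain y' where tr: "\<forall>j\<le>k. dist ((S ^^ j) y') ((S ^^ j) y) < \<eta>"
    and per: "(S ^^ (k + D)) y' = y'"
    using D by blast
  have ge: "real (k + D) * (c - 2 * \<epsilon>) \<le> (\<Sum>j<k + D. f ((T ^^ j) x, (S ^^ j) y'))" for x
  proof -
    have "(\<Sum>j<k. f ((T ^^ j) x, (S ^^ j) y) - \<epsilon>) \<le> (\<Sum>j<k. f ((T ^^ j) x, (S ^^ j) y'))"
    proof (rule sum_mono)
      fix j assume "j \<in> {..<k}"
      \<comment> \<open>Both pairs share the first coordinate, so their distance is that of the
        traced points in the base alone; hence the bound holds for every \<open>x\<close>.\<close>
      then have "dist (f ((T ^^ j) x, (S ^^ j) y')) (f ((T ^^ j) x, (S ^^ j) y)) < \<epsilon>"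
        using tr by (intro \<eta>(2)) (simp add: dist_Pair_Pair)
      then show "f ((T ^^ j) x, (S ^^ j) y) - \<epsilon> \<le> f ((T ^^ j) x, (S ^^ j) y')"
        by (simp add: dist_real_def abs_less_iff)
    qed
    then have 1: "real k * c - real k * \<epsilon> \<le> (\<Sum>j<k. f ((T ^^ j) x, (S ^^ j) y'))"
      using F_ge[of x] by (simp add: sum_subtractf)
    have 2: "- (real D * B) \<le> (\<Sum>j<D. f ((T ^^ (k + j)) x, (S ^^ (k + j)) y'))"
      using sum_bounded_below[of "{..<D}" "- B" "\<lambda>j. f ((T ^^ (k + j)) x, (S ^^ (k + j)) y')"] B
      by (simp add: abs_le_iff minus_le_iff)
    have "(real D * B + real D * (c - 2 * \<epsilon>)) / \<epsilon> < real k" using K k(1) by linarith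
    then have "real D * B + real D * (c - 2 * \<epsilon>) < real k * \<epsilon>" using \<epsilon>(1) by (simp add: field_simps)
    then show ?thesis
      using 1 2 unfolding sum_split_shift of_nat_add distrib_right right_diff_distrib by linarith
  qed
  let ?N = "orbit_average (k + D) S (return borel y')"
  have \<nu>: "?N \<in> inv_measures S"
    using \<open>k > 0\<close> by (intro periodic_orbit_measure(1)[OF S per]) simp
  have "c - 2 * \<epsilon> \<le> psi f T S ?N"
  proof (rule psi_ge[OF comp T S f \<nu>])
    fix L assume "L \<in> inv_measures (\<lambda>(x, y). (T x, S y))" "distr L borel snd = ?N"
    then show "c - 2 * \<epsilon> \<le> integral\<^sup>L L f"
      using \<open>k > 0\<close> ge by (intro integral_over_periodic_orbit_ge[OF T S f B per]) auto
  qed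
  also have "\<dots> \<le> alpha f T S" by (rule psi_le_alpha[OF comp T S f \<nu>])
  finally show False using \<epsilon>(2) by simp
qed

theorem theorem2p10:
  fixes T :: "'a::metric_space \<Rightarrow> 'a" and S :: "'b::metric_space \<Rightarrow> 'b"
    and f :: "'a \<times> 'b \<Rightarrow> real"
  assumes "tds T" and "tds S" and "continuous_on UNIV f"
  shows "(periodic_spec T \<and> periodic_spec S \<longrightarrow> ereal (alpha f T S) \<le> delta f T S)
    \<and> (periodic_spec S \<longrightarrow> delta f T S \<le> ereal (alpha f T S))
    \<and> (periodic_spec T \<and> periodic_spec S \<longrightarrow> ereal (alpha f T S) = delta f T S)"
proof -
  have comp: "compact (UNIV :: 'a set)" "compact (UNIV :: 'b set)"
    and cont: "continuous_on UNIV T" "continuous_on UNIV S"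
    using assms by (auto simp: tds_def)
  note le = alpha_le_delta[OF comp cont assms(3)]
  note ge = delta_le_alpha[OF comp cont assms(3)]
  show ?thesis using le ge by (auto intro: antisym)
qed

end
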